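(* Let $T$ be an $\omega_1$-Aronszajn tree that is semi-special but not special and let $G=T\#\mathbb{N}$. Let $S$ be a special $\omega_1$-Aronszajn tree and let $H=S\#\mathbb{N}$ (built from a partition of $S$ into countably many antichains). Then no graph isomorphic to $G$ is a subdivision of $H$.
   Context: Trees, $\omega_1$-trees, Aronszajn trees as usual; $T^\alpha$ is the level $\alpha$. $T$ is special if it is a union of countably many antichains, semi-special if its successor nodes form a union of countably many antichains. Given a tree $T$ and antichains $\langle A_n:n\in\omega\rangle$ whose union contains all successor nodes, for each node $v$ of limit height define $C(T,v)=\{c^{T,v}_n:n\in\omega\}$ recursively: $l_0$ least with $A_{l_0}\cap[\mathrm{root},v)\ne\emptyset$, $c_0^{T,v}\in A_{l_0}\cap[\mathrm{root},v)$; $l_{n+1}$ least with $A_{l_{n+1}}\cap(c_n^{T,v},v)\neq\emptyset$, $c_{n+1}^{T,v}\in A_{l_{n+1}}\cap(c_n^{T,v},v)$. The ray inflation $T\#\mathbb{N}$ has vertex set $T\times\omega$ and edges $\{(u,n),(u,n+1)\}$; $\{(u,n),(v,n)\}$ for all $n$ whenever $u$ is the predecessor of $v$; and $\{(c^{T,v}_n,n),(v,n)\}$ for $v$ of limit height and $n\in\omega$. $S\#\mathbb{N}$ is defined identically from $S$ and its antichain partition. A subdivision of $H$ is obtained by replacing edges of $H$ by paths with new internal vertices. *)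

theory Defs
  imports Main "HOL-Library.Countable_Set"
begin

definition pred_set :: "'a set \<Rightarrow> ('a \<Rightarrow> 'a \<Rightarrow> bool) \<Rightarrow> 'a \<Rightarrow> 'a set" where
  "pred_set V lt v = {u \<in> V. lt u v}"

text \<open>The (reflexive) order on the predecessors of v; its order type is the height of v.\<close>
definition pred_rel :: "'a set \<Rightarrow> ('a \<Rightarrow> 'a \<Rightarrow> bool) \<Rightarrow> 'a \<Rightarrow> 'a rel" where
  "pred_rel V lt v = {(x, y). x \<in> pred_set V lt v \<and> y \<in> pred_set V lt v \<and> (lt x y \<or> x = y)}"

definition is_tree :: "'a set \<Rightarrow> ('a \<Rightarrow> 'a \<Rightarrow> bool) \<Rightarrow> bool" where
  "is_tree V lt \<longleftrightarrow>
     (\<forall>x\<in>V. \<not> lt x x) \<and>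
     (\<forall>x\<in>V. \<forall>y\<in>V. \<forall>z\<in>V. lt x y \<longrightarrow> lt y z \<longrightarrow> lt x z) \<and>
     (\<forall>v\<in>V. Well_order (pred_rel V lt v)) \<and>
     (\<exists>r\<in>V. \<forall>v\<in>V. v \<noteq> r \<longrightarrow> lt r v)"

definition same_height :: "'a set \<Rightarrow> ('a \<Rightarrow> 'a \<Rightarrow> bool) \<Rightarrow> 'a \<Rightarrow> 'a \<Rightarrow> bool" where
  "same_height V lt u v \<longleftrightarrow> (pred_rel V lt u, pred_rel V lt v) \<in> ordIso"

text \<open>Omega_1-tree: every node has countable height, every countable ordinal
  (represented as a well-order on a subset of nat) is the height of some node,
  and every level is countable.\<close>
definition omega1_tree :: "'a set \<Rightarrow> ('a \<Rightarrow> 'a \<Rightarrow> bool) \<Rightarrow> bool" where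
  "omega1_tree V lt \<longleftrightarrow> is_tree V lt \<and>
     (\<forall>v\<in>V. countable (pred_set V lt v)) \<and>
     (\<forall>r :: nat rel. Well_order r \<longrightarrow> (\<exists>v\<in>V. (pred_rel V lt v, r) \<in> ordIso)) \<and>
     (\<forall>v\<in>V. countable {u \<in> V. same_height V lt u v})"

definition is_chain :: "'a set \<Rightarrow> ('a \<Rightarrow> 'a \<Rightarrow> bool) \<Rightarrow> 'a set \<Rightarrow> bool" where
  "is_chain V lt B \<longleftrightarrow> B \<subseteq> V \<and> (\<forall>x\<in>B. \<forall>y\<in>B. x = y \<or> lt x y \<or> lt y x)"

definition is_branch :: "'a set \<Rightarrow> ('a \<Rightarrow> 'a \<Rightarrow> bool) \<Rightarrow> 'a set \<Rightarrow> bool" where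
  "is_branch V lt B \<longleftrightarrow> is_chain V lt B \<and> (\<forall>C. is_chain V lt C \<longrightarrow> B \<subseteq> C \<longrightarrow> C = B)"

definition aronszajn_tree :: "'a set \<Rightarrow> ('a \<Rightarrow> 'a \<Rightarrow> bool) \<Rightarrow> bool" where
  "aronszajn_tree V lt \<longleftrightarrow> omega1_tree V lt \<and> (\<forall>B. is_branch V lt B \<longrightarrow> countable B)"

definition is_antichain :: "'a set \<Rightarrow> ('a \<Rightarrow> 'a \<Rightarrow> bool) \<Rightarrow> 'a set \<Rightarrow> bool" where
  "is_antichain V lt A \<longleftrightarrow> A \<subseteq> V \<and> (\<forall>x\<in>A. \<forall>y\<in>A. \<not> lt x y)"

definition is_imm_pred :: "'a set \<Rightarrow> ('a \<Rightarrow> 'a \<Rightarrow> bool) \<Rightarrow> 'a \<Rightarrow> 'a \<Rightarrow> bool" where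
  "is_imm_pred V lt u v \<longleftrightarrow> u \<in> V \<and> v \<in> V \<and> lt u v \<and> \<not> (\<exists>w\<in>V. lt u w \<and> lt w v)"

definition succ_node :: "'a set \<Rightarrow> ('a \<Rightarrow> 'a \<Rightarrow> bool) \<Rightarrow> 'a \<Rightarrow> bool" where
  "succ_node V lt v \<longleftrightarrow> v \<in> V \<and> (\<exists>u. is_imm_pred V lt u v)"

definition limit_node :: "'a set \<Rightarrow> ('a \<Rightarrow> 'a \<Rightarrow> bool) \<Rightarrow> 'a \<Rightarrow> bool" where
  "limit_node V lt v \<longleftrightarrow> v \<in> V \<and> pred_set V lt v \<noteq> {} \<and> \<not> (\<exists>u. is_imm_pred V lt u v)"

definition special :: "'a set \<Rightarrow> ('a \<Rightarrow> 'a \<Rightarrow> bool) \<Rightarrow> bool" where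
  "special V lt \<longleftrightarrow> (\<exists>A :: nat \<Rightarrow> 'a set. (\<forall>n. is_antichain V lt (A n)) \<and> V = (\<Union>n. A n))"

definition antichain_cover_succ :: "'a set \<Rightarrow> ('a \<Rightarrow> 'a \<Rightarrow> bool) \<Rightarrow> (nat \<Rightarrow> 'a set) \<Rightarrow> bool" where
  "antichain_cover_succ V lt A \<longleftrightarrow>
     (\<forall>n. is_antichain V lt (A n)) \<and> {v. succ_node V lt v} \<subseteq> (\<Union>n. A n)"

definition semi_special :: "'a set \<Rightarrow> ('a \<Rightarrow> 'a \<Rightarrow> bool) \<Rightarrow> bool" where
  "semi_special V lt \<longleftrightarrow> (\<exists>A. antichain_cover_succ V lt A)"

definition antichain_partition :: "'a set \<Rightarrow> ('a \<Rightarrow> 'a \<Rightarrow> bool) \<Rightarrow> (nat \<Rightarrow> 'a set) \<Rightarrow> bool" where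
  "antichain_partition V lt A \<longleftrightarrow>
     (\<forall>n. is_antichain V lt (A n)) \<and> V = (\<Union>n. A n) \<and>
     (\<forall>m n. m \<noteq> n \<longrightarrow> A m \<inter> A n = {})"

text \<open>cseq V lt A v n = c_n^{T,v}. The chain [root,v) is pred_set V lt v; the
  interval (c,v) is {u in V. lt c u and lt u v}.  Since each A l is an antichain,
  the element chosen is unique.\<close>
primrec cseq :: "'a set \<Rightarrow> ('a \<Rightarrow> 'a \<Rightarrow> bool) \<Rightarrow> (nat \<Rightarrow> 'a set) \<Rightarrow> 'a \<Rightarrow> nat \<Rightarrow> 'a" where
  "cseq V lt A v 0 =
     (let l = (LEAST l. A l \<inter> pred_set V lt v \<noteq> {})
      in THE c. c \<in> A l \<inter> pred_set V lt v)"
| "cseq V lt A v (Suc n) =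
     (let c0 = cseq V lt A v n;
          I = {u \<in> V. lt c0 u \<and> lt u v};
          l = (LEAST l. A l \<inter> I \<noteq> {})
      in THE c. c \<in> A l \<inter> I)"

text \<open>A graph is a pair (vertex set, set of edges), edges being 2-element sets.\<close>
type_synonym 'v graph = "'v set \<times> 'v set set"

definition ray_inflation :: "'a set \<Rightarrow> ('a \<Rightarrow> 'a \<Rightarrow> bool) \<Rightarrow> (nat \<Rightarrow> 'a set) \<Rightarrow> ('a \<times> nat) graph" where
  "ray_inflation V lt A =
     (V \<times> UNIV,
        {{(u, n), (u, Suc n)} | u n. u \<in> V}
      \<union> {{(u, n), (v, n)} | u v n. is_imm_pred V lt u v}
      \<union> {{(cseq V lt A v n, n), (v, n)} | v n. limit_node V lt v})"

definition graph_iso :: "'v graph \<Rightarrow> 'w graph \<Rightarrow> bool" where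
  "graph_iso G G' \<longleftrightarrow> (\<exists>g. bij_betw g (fst G) (fst G') \<and>
     (\<forall>x\<in>fst G. \<forall>y\<in>fst G. {x, y} \<in> snd G \<longleftrightarrow> {g x, g y} \<in> snd G'))"

definition path_edges :: "'v list \<Rightarrow> 'v set set" where
  "path_edges p = {{p ! i, p ! Suc i} | i. Suc i < length p}"

definition inner_vertices :: "'v list \<Rightarrow> 'v set" where
  "inner_vertices p = set (butlast (tl p))"

definition is_subdivision :: "'w graph \<Rightarrow> 'v graph \<Rightarrow> bool" where
  "is_subdivision G' H \<longleftrightarrow>
    (\<exists>(f :: 'v \<Rightarrow> 'w) (P :: 'v set \<Rightarrow> 'w list).
       inj_on f (fst H) \<and>
       (\<forall>e\<in>snd H. length (P e) \<ge> 2 \<and> distinct (P e) \<and>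
            {hd (P e), last (P e)} = f ` e \<and>
            inner_vertices (P e) \<inter> f ` fst H = {}) \<and>
       (\<forall>e\<in>snd H. \<forall>e'\<in>snd H. e \<noteq> e' \<longrightarrow> inner_vertices (P e) \<inter> set (P e') = {}) \<and>
       fst G' = f ` fst H \<union> (\<Union>e\<in>snd H. inner_vertices (P e)) \<and>
       snd G' = (\<Union>e\<in>snd H. path_edges (P e)))"

end

theory Submission
  imports Defs
begin

text \<open>
  A subdivision of \<open>S # \<nat>\<close> retracts onto \<open>S # \<nat>\<close> by sending every inner vertex of a subdivided
  edge to the upper end of that edge. The first coordinate of this retraction is a map \<open>p\<close> from
  \<open>T \<times> \<omega>\<close> to \<open>S\<close> with countable fibres which sends adjacent vertices to comparable nodes.
  Closing off under predecessors and under \<open>p\<close> in both directions yields a rank function on \<open>S\<close> with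
  countable fibres that is monotone and for which \<open>t \<mapsto> rank (p (t, n))\<close> is monotone on \<open>T\<close> and
  independent of \<open>n\<close>. This replaces the usual club of levels at which the two graphs agree.
  For \<open>t\<close> in \<open>T\<close> let \<open>\<sigma> t\<close> be the least node below \<open>p (t, 0)\<close> with the same rank. The part of
  \<open>T # \<nat>\<close> above \<open>t\<close> is connected and avoids all smaller ranks, so its image stays above \<open>\<sigma> t\<close>.
  Colouring \<open>t\<close> by an antichain containing \<open>\<sigma> t\<close> together with the index of \<open>t\<close> in its countable
  rank class shows that \<open>T\<close> is special if \<open>S\<close> is.
\<close>

section \<open>Order in trees: comparability and minimal nodes\<close>

lemma tree_irrefl: "is_tree V lt \<Longrightarrow> x \<in> V \<Longrightarrow> \<not> lt x x"
  by (simp add: is_tree_def)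

lemma tree_trans:
  "is_tree V lt \<Longrightarrow> x \<in> V \<Longrightarrow> y \<in> V \<Longrightarrow> z \<in> V \<Longrightarrow> lt x y \<Longrightarrow> lt y z \<Longrightarrow> lt x z"
  unfolding is_tree_def by blast

lemma Field_pred_rel: "Field (pred_rel V lt v) = pred_set V lt v"
  by (auto simp: pred_rel_def Field_def)

lemma tree_comparable:
  assumes tree: "is_tree V lt" and v: "v \<in> V" and x: "x \<in> V" "x = v \<or> lt x v"
    and y: "y \<in> V" "y = v \<or> lt y v"
  shows "x = y \<or> lt x y \<or> lt y x"
proof -
  have "total_on (pred_set V lt v) (pred_rel V lt v)"
    using tree v unfolding is_tree_def well_order_on_def linear_order_on_def
    by (metis Field_pred_rel)
  then show ?thesis
    using x y unfolding total_on_def by (auto simp: pred_rel_def pred_set_def)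
qed

text \<open>Only the predecessor sets are well-ordered, so the search starts at some
  \<open>v\<close> in \<open>Q\<close>: if \<open>v\<close> is not minimal, the least element of
  \<open>Q\<close> below \<open>v\<close> is, since by transitivity anything under it in
  \<open>Q\<close> would also lie below \<open>v\<close>.\<close>

lemma tree_minimal:
  assumes tree: "is_tree V lt" and Q: "Q \<subseteq> V" "Q \<noteq> {}"
  obtains m where "m \<in> Q" "\<And>y. y \<in> Q \<Longrightarrow> \<not> lt y m"
proof -
  obtain v where v: "v \<in> Q" using Q by blast
  show thesis
  proof (cases "\<exists>y\<in>Q. lt y v")
    case False
    then show thesis using v that by blast
  next
    case True
    then obtain y where y: "y \<in> Q \<inter> pred_set V lt v"
      using Q by (auto simp: pred_set_def)
    have "wf (pred_rel V lt v - Id)"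
      using tree v Q unfolding is_tree_def well_order_on_def by blast
    then obtain m where m: "m \<in> Q \<inter> pred_set V lt v"
      and min: "\<And>y. (y, m) \<in> pred_rel V lt v - Id \<Longrightarrow> y \<notin> Q \<inter> pred_set V lt v"
      using wfE_min[OF _ y] by metis
    have "\<not> lt z m" if z: "z \<in> Q" for z
    proof
      assume lt: "lt z m"
      have "z \<in> V" "m \<in> V" "v \<in> V" "lt m v" using z m v Q by (auto simp: pred_set_def)
      then have "lt z v" using tree_trans[OF tree, of z m v] lt by simp
      then have "z \<in> pred_set V lt v" using \<open>z \<in> V\<close> by (simp add: pred_set_def)
      moreover have "z \<noteq> m" using tree_irrefl[OF tree \<open>m \<in> V\<close>] lt by blast
      ultimately show False using min[of z] z m lt by (auto simp: pred_rel_def)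
    qed
    then show thesis using m that by blast
  qed
qed

section \<open>The sequences \<open>cseq\<close> below limit nodes\<close>

text \<open>The least node strictly between \<open>t\<close> and \<open>v\<close> has
  \<open>t\<close> as immediate predecessor. Hence every interval in the recursion for
  \<open>cseq\<close> meets the antichains, although these need only cover successor nodes.\<close>

lemma succ_node_below_limit:
  assumes tree: "is_tree V lt" and v: "limit_node V lt v" and t: "t \<in> V" "lt t v"
  obtains w where "succ_node V lt w" "w \<in> V" "lt t w" "lt w v"
proof -
  let ?Q = "{w \<in> V. lt t w \<and> lt w v}"
  have vV: "v \<in> V" using v by (simp add: limit_node_def)
  have "?Q \<noteq> {}" using v t by (auto simp: limit_node_def is_imm_pred_def)
  then obtain m where m: "m \<in> ?Q" and min: "\<And>y. y \<in> ?Q \<Longrightarrow> \<not> lt y m"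
    using tree_minimal[OF tree, of ?Q] by blast
  have "is_imm_pred V lt t m"
    unfolding is_imm_pred_def using m t min tree_trans[OF tree _ _ vV] by blast
  then have "succ_node V lt m" using m by (auto simp: succ_node_def)
  then show thesis using m that by blast
qed

text \<open>Justifies both \<open>LEAST\<close> and \<open>THE\<close> in \<open>cseq\<close>:
  \<open>I\<close> is a chain below \<open>v\<close>, so an antichain meets it at most once, and
  \<open>w\<close> ensures that some antichain meets it. Leaving \<open>I\<close> general serves
  both clauses of the recursion.\<close>

lemma the_least_antichain_element:
  assumes tree: "is_tree V lt" and cov: "antichain_cover_succ V lt A" and v: "v \<in> V"
    and I: "I \<subseteq> pred_set V lt v" and ne: "w \<in> I" "succ_node V lt w"
  defines "l \<equiv> LEAST l. A l \<inter> I \<noteq> {}"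
  shows "(THE c. c \<in> A l \<inter> I) \<in> A l \<inter> I" and "\<And>k x. x \<in> A k \<inter> I \<Longrightarrow> l \<le> k"
proof -
  obtain k where "w \<in> A k" using cov ne by (auto simp: antichain_cover_succ_def)
  then have "A l \<inter> I \<noteq> {}" unfolding l_def using ne by (intro LeastI[of "\<lambda>l. A l \<inter> I \<noteq> {}" k]) blast
  then obtain c where c: "c \<in> A l \<inter> I" by blast
  have "d = c" if d: "d \<in> A l \<inter> I" for d
  proof -
    have "c \<in> V" "lt c v" "d \<in> V" "lt d v" using c d I by (auto simp: pred_set_def)
    then have "d = c \<or> lt d c \<or> lt c d" using tree_comparable[OF tree v] by blast
    moreover have "is_antichain V lt (A l)" using cov by (simp add: antichain_cover_succ_def)
    ultimately show ?thesis using c d unfolding is_antichain_def by blast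
  qed
  with c show "(THE c. c \<in> A l \<inter> I) \<in> A l \<inter> I" by (rule theI[of "\<lambda>c. c \<in> A l \<inter> I"])
  show "l \<le> k" if "x \<in> A k \<inter> I" for k x
    unfolding l_def using that by (intro Least_le[of "\<lambda>l. A l \<inter> I \<noteq> {}"]) blast
qed

lemma cseq_in_pred_set:
  assumes tree: "is_tree V lt" and cov: "antichain_cover_succ V lt A" and v: "limit_node V lt v"
  shows "cseq V lt A v n \<in> pred_set V lt v"
proof (induction n)
  case 0
  have vV: "v \<in> V" using v by (simp add: limit_node_def)
  obtain t where "t \<in> pred_set V lt v" using v by (auto simp: limit_node_def)
  then obtain w where "succ_node V lt w" "w \<in> pred_set V lt v"
    using succ_node_below_limit[OF tree v, of t] by (auto simp: pred_set_def)
  from the_least_antichain_element(1)[OF tree cov vV subset_refl this(2,1)]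
  show ?case by (simp add: Let_def)
next
  case (Suc n)
  have vV: "v \<in> V" using v by (simp add: limit_node_def)
  let ?I = "{u \<in> V. lt (cseq V lt A v n) u \<and> lt u v}"
  have I: "?I \<subseteq> pred_set V lt v" by (auto simp: pred_set_def)
  obtain w where "succ_node V lt w" "w \<in> ?I"
    using succ_node_below_limit[OF tree v, of "cseq V lt A v n"] Suc by (auto simp: pred_set_def)
  from the_least_antichain_element(1)[OF tree cov vV I this(2,1)]
  show ?case using I by (auto simp: Let_def)
qed

text \<open>If the sequence stayed below \<open>t\<close>, a successor node \<open>w\<close> between
  \<open>t\<close> and \<open>v\<close> would be a candidate at every step, so the chosen indices
  would be bounded by the index of an antichain containing \<open>w\<close>. But the sequence
  increases strictly and thus never uses an antichain twice.\<close>

lemma cseq_cofinal: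
  assumes tree: "is_tree V lt" and cov: "antichain_cover_succ V lt A" and v: "limit_node V lt v"
    and t: "t \<in> V" "lt t v"
  shows "\<exists>n. t = cseq V lt A v n \<or> lt t (cseq V lt A v n)"
proof (rule ccontr)
  assume neg: "\<not> ?thesis"
  let ?c = "cseq V lt A v"
  have vV: "v \<in> V" using v by (simp add: limit_node_def)
  have cV: "?c n \<in> V" "lt (?c n) v" for n
    using cseq_in_pred_set[OF tree cov v, of n] by (auto simp: pred_set_def)
  have ct: "lt (?c n) t" for n
    using neg tree_comparable[OF tree vV, of t "?c n"] t cV by blast
  obtain w where w: "succ_node V lt w" "w \<in> V" "lt t w" "lt w v"
    using succ_node_below_limit[OF tree v t] by blast
  have cw: "lt (?c n) w" for n using tree_trans[OF tree cV(1) t(1) w(2) ct w(3)] .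
  obtain m where m: "w \<in> A m" using cov w by (auto simp: antichain_cover_succ_def)
  have step: "\<exists>l\<le>m. ?c (Suc n) \<in> A l" "lt (?c n) (?c (Suc n))" for n
  proof -
    let ?I = "{u \<in> V. lt (?c n) u \<and> lt u v}"
    have I: "?I \<subseteq> pred_set V lt v" by (auto simp: pred_set_def)
    have wI: "w \<in> ?I" using w cw by blast
    note least = the_least_antichain_element[OF tree cov vV I wI w(1)]
    have c: "?c (Suc n) \<in> A (LEAST l. A l \<inter> ?I \<noteq> {}) \<inter> ?I"
      using least(1) by (simp add: Let_def)
    show "\<exists>l\<le>m. ?c (Suc n) \<in> A l" using c least(2)[of w m] m wI by blast
    show "lt (?c n) (?c (Suc n))" using c by blast
  qed
  \<comment> \<open>\<open>l n\<close> is the index used for term \<open>Suc n\<close>; term 0 comes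
    from the base clause and is left out of the pigeonhole count.\<close>
  obtain l where l: "\<And>n. l n \<le> m" "\<And>n. ?c (Suc n) \<in> A (l n)" using step(1) by metis
  have mono: "lt (?c i) (?c (Suc (i + d)))" for i d
  proof (induction d)
    case 0
    show ?case using step(2)[of i] by simp
  next
    case (Suc d)
    show ?case
      using tree_trans[OF tree cV(1) cV(1) cV(1) Suc step(2)[of "Suc (i + d)"]]
      by (simp only: add_Suc_right)
  qed
  have "l i \<noteq> l j" if "i < j" for i j
  proof -
    obtain d where "j = Suc (i + d)" using \<open>i < j\<close> less_imp_Suc_add by blast
    then have "lt (?c (Suc i)) (?c (Suc j))" using mono[of "Suc i" d] by simp
    then show ?thesis using l(2) cov unfolding antichain_cover_succ_def is_antichain_def by metis
  qed
  then have "inj l" by (metis injI linorder_neqE_nat)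
  moreover have "range l \<subseteq> {..m}" using l(1) by auto
  ultimately show False using finite_subset[of "range l"] finite_imageD[of l UNIV] by auto
qed

section \<open>Edges and cones of the ray inflation\<close>

lemma ray_inflation_edge_cases:
  assumes tree: "is_tree V lt" and cov: "antichain_cover_succ V lt A"
    and e: "e \<in> snd (ray_inflation V lt A)"
  obtains x y where "e = {x, y}" "x \<in> V \<times> UNIV" "y \<in> V \<times> UNIV" "fst x = fst y \<or> lt (fst x) (fst y)"
proof -
  consider u n where "e = {(u, n), (u, Suc n)}" "u \<in> V"
    | u v n where "e = {(u, n), (v, n)}" "is_imm_pred V lt u v"
    | v n where "e = {(cseq V lt A v n, n), (v, n)}" "limit_node V lt v"
    using e unfolding ray_inflation_def by auto
  then show thesis
  proof cases
    case 1
    then show thesis by (intro that[of "(u, n)" "(u, Suc n)"]) auto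
  next
    case 2
    then show thesis by (intro that[of "(u, n)" "(v, n)"]) (auto simp: is_imm_pred_def)
  next
    case 3
    then show thesis
      using cseq_in_pred_set[OF tree cov 3(2), of n]
      by (intro that[of "(cseq V lt A v n, n)" "(v, n)"]) (auto simp: limit_node_def pred_set_def)
  qed
qed

text \<open>Connectedness of the cone above \<open>t\<close>, phrased as induction along edges that
  stay inside it. A minimal failing node \<open>w\<close> differs from \<open>t\<close> and has an
  edge down to a node of the cone, namely its immediate predecessor or, by cofinality, some term of
  \<open>cseq\<close> at \<open>w\<close>.\<close>

lemma ray_inflation_cone_induct:
  assumes tree: "is_tree V lt" and cov: "antichain_cover_succ V lt A"
    and t: "t \<in> V" and Qt: "Q (t, k)"
    and step: "\<And>x y. \<lbrakk>{x, y} \<in> snd (ray_inflation V lt A); x \<in> V \<times> UNIV; y \<in> V \<times> UNIV;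
      fst x = t \<or> lt t (fst x); fst y = t \<or> lt t (fst y); Q x\<rbrakk> \<Longrightarrow> Q y"
    and v: "v \<in> V" "v = t \<or> lt t v"
  shows "Q (v, n)"
proof -
  \<comment> \<open>One vertex of a ray suffices: descend to index 0, then climb to any
    index.\<close>
  have ray: "Q (u, i)" if u: "u \<in> V" "u = t \<or> lt t u" and Q: "Q (u, j)" for u i j
  proof -
    have e: "{(u, i), (u, Suc i)} \<in> snd (ray_inflation V lt A)" for i
      using u by (auto simp: ray_inflation_def)
    have up: "Q (u, Suc i)" if "Q (u, i)" for i
      using step[OF e[of i]] that u by simp
    have down: "Q (u, i)" if "Q (u, Suc i)" for i
      using step[of "(u, Suc i)" "(u, i)"] e[of i] that u by (simp add: insert_commute)
    have zero: "Q (u, 0)" using Q by (induction j) (auto dest: down)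
    show ?thesis by (induction i) (auto intro: zero up)
  qed
  define F where "F = {w \<in> V. (w = t \<or> lt t w) \<and> (\<exists>n. \<not> Q (w, n))}"
  have "F = {}"
  proof (rule ccontr)
    assume "F \<noteq> {}"
    then obtain w where w: "w \<in> F" and min: "\<And>y. y \<in> F \<Longrightarrow> \<not> lt y w"
      using tree_minimal[OF tree, of F] by (auto simp: F_def)
    have wV: "w \<in> V" using w by (simp add: F_def)
    have "w \<noteq> t" using w ray[OF t _ Qt] by (auto simp: F_def)
    then have tw: "lt t w" using w by (simp add: F_def)
    have "\<exists>u i. u \<in> V \<and> lt u w \<and> (u = t \<or> lt t u) \<and> {(u, i), (w, i)} \<in> snd (ray_inflation V lt A)"
    proof (cases "\<exists>u. is_imm_pred V lt u w")
      case True
      then obtain u where u: "is_imm_pred V lt u w" by blast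
      then have "u \<in> V" "lt u w" "\<not> lt u t" using t tw by (auto simp: is_imm_pred_def)
      \<comment> \<open>\<open>u\<close> cannot lie strictly below \<open>t\<close>, for then
        \<open>t\<close> would separate \<open>u\<close> from its immediate successor
        \<open>w\<close>.\<close>
      moreover have "u = t \<or> lt t u"
        using tree_comparable[OF tree wV, of u t] calculation t tw by blast
      moreover have "{(u, 0), (w, 0)} \<in> snd (ray_inflation V lt A)"
        using u by (auto simp: ray_inflation_def)
      ultimately show ?thesis by blast
    next
      case False
      then have lim: "limit_node V lt w"
        using wV t tw by (auto simp: limit_node_def pred_set_def)
      obtain i where i: "t = cseq V lt A w i \<or> lt t (cseq V lt A w i)"
        using cseq_cofinal[OF tree cov lim t tw] by blast
      have "{(cseq V lt A w i, i), (w, i)} \<in> snd (ray_inflation V lt A)"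
        using lim by (auto simp: ray_inflation_def)
      then show ?thesis
        using i cseq_in_pred_set[OF tree cov lim, of i] by (auto simp: pred_set_def)
    qed
    then obtain u i where u: "u \<in> V" "lt u w" "u = t \<or> lt t u"
      and e: "{(u, i), (w, i)} \<in> snd (ray_inflation V lt A)" by blast
    have "u \<notin> F" using min u(2) by blast
    then have "Q (u, i)" using u by (simp add: F_def)
    then have "Q (w, i)" using step[OF e] u wV tw by simp
    then show False using ray[of w i] w by (auto simp: F_def)
  qed
  then show ?thesis using v by (auto simp: F_def)
qed

section \<open>Monotone rank functions with countable fibres\<close>

lemma countable_rtrancl_Image:
  assumes "\<And>x. countable (E `` {x})"
  shows "countable (E\<^sup>* `` {x})"
proof -
  have "countable ((E ^^ n) `` {x})" for n
  proof (induction n)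
    case (Suc n)
    have "(E ^^ Suc n) `` {x} = (\<Union>y\<in>(E ^^ n) `` {x}. E `` {y})" by auto
    then show ?case using Suc assms by simp
  qed simp
  moreover have "E\<^sup>* `` {x} = (\<Union>n. (E ^^ n) `` {x})" by (auto simp: rtrancl_power)
  ultimately show ?thesis by simp
qed

text \<open>The rank of \<open>x\<close> is the \<open>r\<close>-least point from which
  \<open>x\<close> can be reached along \<open>E\<close>. Whatever reaches \<open>x\<close> also
  reaches its \<open>E\<close>-successors, so ranks never increase along \<open>E\<close>; the fibre
  over \<open>a\<close> consists of points reachable from \<open>a\<close>, of which there are
  countably many.\<close>

lemma monotone_rank_countable_fibres:
  fixes E :: "'b rel"
  assumes E: "\<And>x. countable (E `` {x})"
  obtains r :: "'b rel" and rk :: "'b \<Rightarrow> 'b" where "well_order_on UNIV r"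
    "\<And>x y. (x, y) \<in> E \<Longrightarrow> (rk y, rk x) \<in> r" "\<And>a. countable {x. rk x = a}"
proof -
  obtain r :: "'b rel" where r: "well_order_on UNIV r" using well_order_on by blast
  have wf: "wf (r - Id)" and tot: "total r" and refl: "refl r"
    using r unfolding well_order_on_def linear_order_on_def partial_order_on_def preorder_on_def by auto
  have "\<exists>a. (a, x) \<in> E\<^sup>* \<and> (\<forall>b. (b, x) \<in> E\<^sup>* \<longrightarrow> (a, b) \<in> r)" for x
  proof -
    obtain a where a: "a \<in> {a. (a, x) \<in> E\<^sup>*}"
      and min: "\<And>b. (b, a) \<in> r - Id \<Longrightarrow> b \<notin> {a. (a, x) \<in> E\<^sup>*}"
      using wfE_min[OF wf, of x "{a. (a, x) \<in> E\<^sup>*}"] by blast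
    have "(a, b) \<in> r" if "(b, x) \<in> E\<^sup>*" for b
      using min[of b] that tot refl by (cases "b = a") (auto simp: total_on_def refl_on_def)
    with a show ?thesis by blast
  qed
  then obtain rk where rk: "\<And>x. (rk x, x) \<in> E\<^sup>*" "\<And>x b. (b, x) \<in> E\<^sup>* \<Longrightarrow> (rk x, b) \<in> r"
    by metis
  have "(rk y, rk x) \<in> r" if "(x, y) \<in> E" for x y
    using rk(2) rtrancl_into_rtrancl[OF rk(1) that] .
  moreover have "countable {x. rk x = a}" for a
    using countable_rtrancl_Image[OF E, of a] rk(1) by (auto elim!: countable_subset[rotated])
  ultimately show thesis using that r by blast
qed

section \<open>Transferring specialness from \<open>S\<close> to \<open>T\<close>\<close>

lemma special_if_colouring:
  assumes "\<And>x y. \<lbrakk>x \<in> V; y \<in> V; lt x y\<rbrakk> \<Longrightarrow> c x \<noteq> (c y :: nat)"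
  shows "special V lt"
  unfolding special_def
proof (intro exI conjI allI)
  show "is_antichain V lt {x \<in> V. c x = n}" for n
    using assms unfolding is_antichain_def by blast
  show "V = (\<Union>n. {x \<in> V. c x = n})" by auto
qed

lemma special_transfer:
  fixes p :: "'a \<times> nat \<Rightarrow> 'b"
  assumes T: "is_tree T ltT" "\<And>v. v \<in> T \<Longrightarrow> countable (pred_set T ltT v)"
    and A: "antichain_cover_succ T ltT A"
    and S: "is_tree S ltS" "\<And>v. v \<in> S \<Longrightarrow> countable (pred_set S ltS v)" "special S ltS"
    and p: "\<And>x. x \<in> T \<times> UNIV \<Longrightarrow> p x \<in> S" "\<And>s. s \<in> S \<Longrightarrow> countable {x \<in> T \<times> UNIV. p x = s}"
    and edge: "\<And>x y. \<lbrakk>{x, y} \<in> snd (ray_inflation T ltT A); x \<in> T \<times> UNIV; y \<in> T \<times> UNIV\<rbrakk>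
      \<Longrightarrow> p x = p y \<or> ltS (p x) (p y) \<or> ltS (p y) (p x)"
  shows "special T ltT"
proof -
  \<comment> \<open>\<open>E\<close> leads from a node to nodes whose rank must not be larger: its
    predecessors in \<open>S\<close>, and the images of all rays at or below any \<open>t\<close>
    whose ray meets its fibre. Countable fibres of \<open>p\<close> and countable predecessor sets
    keep each \<open>E\<close>-image countable.\<close>
  define E where "E = {(s, s'). s \<in> S \<and> s' \<in> S \<and> ltS s' s} \<union>
    {(p (t, n), p (t', m)) | t t' n m. t \<in> T \<and> t' \<in> T \<and> (t' = t \<or> ltT t' t)}"
  have "countable (E `` {s})" for s
  proof (cases "s \<in> S")
    case True
    let ?F = "{x \<in> T \<times> UNIV. p x = s}"
    have "E `` {s} \<subseteq> pred_set S ltS s \<union>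
        p ` (\<Union>x\<in>?F. (insert (fst x) (pred_set T ltT (fst x))) \<times> UNIV)"
      by (force simp: E_def pred_set_def)
    moreover have "countable (pred_set S ltS s \<union>
        p ` (\<Union>x\<in>?F. (insert (fst x) (pred_set T ltT (fst x))) \<times> UNIV))"
      using S(2) p(2) T(2) True by (intro countable_Un countable_image countable_UN) auto
    ultimately show ?thesis by (rule countable_subset)
  next
    case False
    then have "E `` {s} = {}" using p(1) by (auto simp: E_def)
    then show ?thesis by simp
  qed
  then obtain r :: "'b rel" and rk where r: "well_order_on UNIV r"
    and rk: "\<And>x y. (x, y) \<in> E \<Longrightarrow> (rk y, rk x) \<in> r" and fib: "\<And>a. countable {x. rk x = a}"
    using monotone_rank_countable_fibres[of E] by blast
  have anti: "\<And>a b. (a, b) \<in> r \<Longrightarrow> (b, a) \<in> r \<Longrightarrow> a = b"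
    and trans: "\<And>a b c. (a, b) \<in> r \<Longrightarrow> (b, c) \<in> r \<Longrightarrow> (a, c) \<in> r"
    and refl: "\<And>a. (a, a) \<in> r"
    using r unfolding well_order_on_def linear_order_on_def partial_order_on_def preorder_on_def
      antisym_def trans_def refl_on_def by blast+
  define rT where "rT t = rk (p (t, 0))" for t
  \<comment> \<open>The case \<open>t' = t\<close> in \<open>E\<close> relates any two vertices of
    one ray in both directions, so antisymmetry forces equal ranks.\<close>
  have rT: "rk (p (t, n)) = rT t" if "t \<in> T" for t n
    unfolding rT_def using that by (intro anti rk) (auto simp: E_def)
  have rT_mono: "(rT t, rT t') \<in> r" if "t \<in> T" "t' \<in> T" "t' = t \<or> ltT t t'" for t t'
    unfolding rT_def using that by (intro rk) (auto simp: E_def)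
  have rk_mono: "(rk s, rk s') \<in> r" if "s \<in> S" "s' \<in> S" "ltS s s'" for s s'
    using that by (intro rk) (auto simp: E_def)
  define above where "above t w = (w \<in> S \<and> (rT t, rk w) \<in> r)" for t w
  \<comment> \<open>A minimal choice among the nodes at or below \<open>p (t, 0)\<close> is minimal
    among all nodes of rank at least \<open>rT t\<close>, because anything under it is again below
    \<open>p (t, 0)\<close>.\<close>
  have "\<exists>w. above t w \<and> (w = p (t, 0) \<or> ltS w (p (t, 0))) \<and> (\<forall>y. above t y \<longrightarrow> \<not> ltS y w)"
    if t: "t \<in> T" for t
  proof -
    have pS: "p (t, 0) \<in> S" using p(1) t by simp
    let ?Q = "{w. above t w \<and> (w = p (t, 0) \<or> ltS w (p (t, 0)))}"
    have "p (t, 0) \<in> ?Q" using pS refl by (simp add: above_def rT_def)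
    moreover have "?Q \<subseteq> S" by (auto simp: above_def)
    ultimately obtain w where w: "w \<in> ?Q" and min: "\<And>y. y \<in> ?Q \<Longrightarrow> \<not> ltS y w"
      using tree_minimal[OF S(1), of ?Q] by blast
    have "\<not> ltS y w" if "above t y" for y
      using min[of y] w that tree_trans[OF S(1) _ _ pS, of y w] by (auto simp: above_def)
    with w show ?thesis by blast
  qed
  then obtain \<sigma> where \<sigma>: "\<And>t. t \<in> T \<Longrightarrow> above t (\<sigma> t)"
    "\<And>t. t \<in> T \<Longrightarrow> \<sigma> t = p (t, 0) \<or> ltS (\<sigma> t) (p (t, 0))"
    "\<And>t y. t \<in> T \<Longrightarrow> above t y \<Longrightarrow> \<not> ltS y (\<sigma> t)"
    by metis
  have \<sigma>S: "\<sigma> t \<in> S" if "t \<in> T" for t using \<sigma>(1)[OF that] by (simp add: above_def)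
  have rk_\<sigma>: "rk (\<sigma> t) = rT t" if t: "t \<in> T" for t
  proof (rule anti)
    show "(rT t, rk (\<sigma> t)) \<in> r" using \<sigma>(1)[OF t] by (simp add: above_def)
    show "(rk (\<sigma> t), rT t) \<in> r"
      using \<sigma>(2)[OF t] rk_mono[OF \<sigma>S[OF t], of "p (t, 0)"] p(1) t refl by (auto simp: rT_def)
  qed
  have cone: "\<sigma> t = p (t', 0) \<or> ltS (\<sigma> t) (p (t', 0))"
    if t: "t \<in> T" and t': "t' \<in> T" "ltT t t'" for t t'
  proof (rule ray_inflation_cone_induct[OF T(1) A t, where Q = "\<lambda>x. \<sigma> t = p x \<or> ltS (\<sigma> t) (p x)"])
    show "\<sigma> t = p (t, 0) \<or> ltS (\<sigma> t) (p (t, 0))" using \<sigma>(2)[OF t] .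
    show "t' \<in> T" "t' = t \<or> ltT t t'" using t' by auto
  next
    fix x y
    assume e: "{x, y} \<in> snd (ray_inflation T ltT A)" and x: "x \<in> T \<times> UNIV" and y: "y \<in> T \<times> UNIV"
      and cy: "fst y = t \<or> ltT t (fst y)" and Qx: "\<sigma> t = p x \<or> ltS (\<sigma> t) (p x)"
    have pS: "p x \<in> S" "p y \<in> S" using p(1) x y by auto
    \<comment> \<open>Inside the cone ranks do not drop under \<open>rT t\<close>, so minimality
      keeps \<open>p y\<close> from lying strictly below \<open>\<sigma> t\<close>. On a step down
      from \<open>p x\<close>, both \<open>p y\<close> and \<open>\<sigma> t\<close> are at or below
      \<open>p x\<close>, hence comparable, which leaves only the desired order.\<close>
    have "above t (p y)"
      using rT_mono[OF t, of "fst y"] rT[of "fst y" "snd y"] y cy pS by (auto simp: above_def)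
    then have nlt: "\<not> ltS (p y) (\<sigma> t)" using \<sigma>(3)[OF t] by blast
    show "\<sigma> t = p y \<or> ltS (\<sigma> t) (p y)"
      using edge[OF e x y]
    proof (elim disjE)
      assume "ltS (p x) (p y)"
      then show ?thesis using Qx tree_trans[OF S(1) \<sigma>S[OF t] pS] by auto
    next
      assume "ltS (p y) (p x)"
      then show ?thesis
        using tree_comparable[OF S(1) pS(1) \<sigma>S[OF t] Qx pS(2)] nlt by blast
    qed (use Qx in auto)
  qed
  obtain C :: "nat \<Rightarrow> 'b set" where C: "\<And>n. is_antichain S ltS (C n)" "S = (\<Union>n. C n)"
    using S(3) unfolding special_def by blast
  have "\<forall>t\<in>T. \<exists>n. \<sigma> t \<in> C n" using \<sigma>S C(2) by blast
  then obtain k where k: "\<And>t. t \<in> T \<Longrightarrow> \<sigma> t \<in> C (k t)" by metis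
  \<comment> \<open>Countably many nodes of \<open>S\<close> share a rank, and each has a countable
    fibre under \<open>p\<close>.\<close>
  have cls: "countable {u \<in> T. rT u = a}" for a
  proof (rule countable_subset)
    let ?F = "\<Union>s\<in>{s. rk s = a} \<inter> S. {x \<in> T \<times> UNIV. p x = s}"
    show "{u \<in> T. rT u = a} \<subseteq> fst ` ?F"
    proof
      fix u assume "u \<in> {u \<in> T. rT u = a}"
      then have "(u, 0) \<in> ?F" using p(1)[of "(u, 0)"] by (auto simp: rT_def)
      then show "u \<in> fst ` ?F" by force
    qed
    show "countable (fst ` ?F)" using fib p(2) by (intro countable_image countable_UN) auto
  qed
  define idx where "idx t = to_nat_on {u \<in> T. rT u = rT t} t" for t
  \<comment> \<open>Within a rank class \<open>idx\<close> separates the nodes. Across classes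
    \<open>\<sigma>\<close> takes values of different rank, and for comparable \<open>t\<close>,
    \<open>t'\<close> these values are comparable, so they cannot share an antichain.\<close>
  show ?thesis
  proof (rule special_if_colouring[where c = "\<lambda>t. prod_encode (k t, idx t)"], rule notI)
    fix t t'
    assume t: "t \<in> T" "t' \<in> T" "ltT t t'" and "prod_encode (k t, idx t) = prod_encode (k t', idx t')"
    then have eq: "k t = k t'" "idx t = idx t'" by auto
    have ne: "rT t \<noteq> rT t'"
    proof
      assume "rT t = rT t'"
      then have "t = t'"
        using eq(2) t inj_on_to_nat_on[OF cls[of "rT t"]] unfolding idx_def inj_on_def by auto
      then show False using t tree_irrefl[OF T(1)] by blast
    qed
    \<comment> \<open>Both nodes are at or below \<open>p (t', 0)\<close>: the first by
      \<open>cone\<close>, the second by the choice of \<open>\<sigma>\<close>.\<close>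
    have "\<sigma> t = \<sigma> t' \<or> ltS (\<sigma> t) (\<sigma> t') \<or> ltS (\<sigma> t') (\<sigma> t)"
      using tree_comparable[OF S(1) _ \<sigma>S cone \<sigma>S \<sigma>(2)] p(1)[of "(t', 0)"] t by simp
    moreover have "\<sigma> t \<noteq> \<sigma> t'" using ne rk_\<sigma> t by metis
    ultimately show False
      using k[OF t(1)] k[OF t(2)] C(1)[of "k t"] eq(1) by (auto simp: is_antichain_def)
  qed
qed

section \<open>Retracting a subdivision onto the ray inflation\<close>

lemma set_path_subset:
  assumes "length q \<ge> 2"
  shows "set q \<subseteq> {hd q, last q} \<union> inner_vertices q"
proof -
  obtain x y ys where q: "q = x # y # ys"
    using assms by (cases q; cases "tl q") auto
  have "set (y # ys) = insert (last (y # ys)) (set (butlast (y # ys)))"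
    by (metis append_butlast_last_id list.distinct(1) list.set(2) set_append Un_commute
        insert_is_Un list.set(1))
  then show ?thesis unfolding q inner_vertices_def by auto
qed

text \<open>All vertices on a subdivided edge are sent to ends of that edge, which gives
  comparability. Using the upper end for inner vertices keeps fibres countable: a node may have
  uncountably many edges going up, but an edge with upper end over \<open>s\<close> starts over
  \<open>s\<close> or one of its countably many predecessors.\<close>

lemma subdivision_retraction:
  fixes S :: "'b set" and G' :: "'c graph"
  assumes S: "is_tree S ltS" "\<And>v. v \<in> S \<Longrightarrow> countable (pred_set S ltS v)"
    and B: "antichain_cover_succ S ltS B"
    and sub: "is_subdivision G' (ray_inflation S ltS B)"
  obtains q :: "'c \<Rightarrow> 'b" where "\<And>w. w \<in> fst G' \<Longrightarrow> q w \<in> S"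
    "\<And>s. s \<in> S \<Longrightarrow> countable {w \<in> fst G'. q w = s}"
    "\<And>x y. {x, y} \<in> snd G' \<Longrightarrow> q x = q y \<or> ltS (q x) (q y) \<or> ltS (q y) (q x)"
proof -
  let ?H = "ray_inflation S ltS B"
  let ?inner = "\<lambda>P e. inner_vertices (P e)"
  from sub obtain f :: "'b \<times> nat \<Rightarrow> 'c" and P where
    "inj_on f (fst ?H) \<and>
       (\<forall>e\<in>snd ?H. length (P e) \<ge> 2 \<and> distinct (P e) \<and>
            {hd (P e), last (P e)} = f ` e \<and> ?inner P e \<inter> f ` fst ?H = {}) \<and>
       (\<forall>e\<in>snd ?H. \<forall>e'\<in>snd ?H. e \<noteq> e' \<longrightarrow> ?inner P e \<inter> set (P e') = {}) \<and>
       fst G' = f ` fst ?H \<union> (\<Union>e\<in>snd ?H. ?inner P e) \<and>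
       snd G' = (\<Union>e\<in>snd ?H. path_edges (P e))"
    unfolding is_subdivision_def by (elim exE) rule
  then have inj: "inj_on f (fst ?H)"
    and path: "\<And>e. e \<in> snd ?H \<Longrightarrow> length (P e) \<ge> 2"
    and ends: "\<And>e. e \<in> snd ?H \<Longrightarrow> {hd (P e), last (P e)} = f ` e"
    and inner: "\<And>e. e \<in> snd ?H \<Longrightarrow> ?inner P e \<inter> f ` fst ?H = {}"
    and disj: "\<And>e e'. e \<in> snd ?H \<Longrightarrow> e' \<in> snd ?H \<Longrightarrow> e \<noteq> e' \<Longrightarrow> ?inner P e \<inter> set (P e') = {}"
    and V': "fst G' = f ` fst ?H \<union> (\<Union>e\<in>snd ?H. ?inner P e)"
    and E': "snd G' = (\<Union>e\<in>snd ?H. path_edges (P e))"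
    by simp_all
  have VH: "fst ?H = S \<times> UNIV" by (simp add: ray_inflation_def)
  have "\<forall>e\<in>snd ?H. \<exists>x y. e = {x, y} \<and> x \<in> S \<times> UNIV \<and> y \<in> S \<times> UNIV \<and>
      (fst x = fst y \<or> ltS (fst x) (fst y))"
    using ray_inflation_edge_cases[OF S(1) B] by metis
  then obtain lo hi where e: "\<And>e. e \<in> snd ?H \<Longrightarrow> e = {lo e, hi e} \<and> lo e \<in> S \<times> UNIV \<and>
      hi e \<in> S \<times> UNIV \<and> (fst (lo e) = fst (hi e) \<or> ltS (fst (lo e)) (fst (hi e)))"
    by metis
  \<comment> \<open>Branch vertices return to their preimage under \<open>f\<close>. For an inner
    vertex the \<open>SOME\<close> is determined, since inner vertices of one path lie on no other
    path.\<close>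
  define \<psi> where "\<psi> w = (if w \<in> f ` fst ?H then inv_into (fst ?H) f w
    else hi (SOME e. e \<in> snd ?H \<and> w \<in> ?inner P e))" for w
  have \<psi>f: "\<psi> (f x) = x" if "x \<in> fst ?H" for x
    using that inj by (simp add: \<psi>_def)
  have inner_set: "?inner P e \<subseteq> set (P e)" for e
    unfolding inner_vertices_def by (cases "P e") (auto dest: in_set_butlastD)
  have \<psi>i: "\<psi> w = hi e" if we: "e \<in> snd ?H" "w \<in> ?inner P e" for w e
  proof -
    have "w \<notin> f ` fst ?H" using inner we by blast
    moreover have "(SOME e. e \<in> snd ?H \<and> w \<in> ?inner P e) = e"
      using we disj inner_set by (intro some_equality) blast+
    ultimately show ?thesis by (simp add: \<psi>_def)
  qed
  have \<psi>P: "\<psi> w \<in> e" if we: "e \<in> snd ?H" "w \<in> set (P e)" for w e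
  proof -
    have "w \<in> f ` e \<or> w \<in> ?inner P e"
      using set_path_subset[OF path[OF we(1)]] ends[OF we(1)] we(2) by blast
    moreover have "e \<subseteq> fst ?H" using e[OF we(1)] VH by auto
    ultimately show ?thesis using \<psi>f \<psi>i[OF we(1), of w] e[OF we(1)] by auto
  qed
  show thesis
  proof (rule that[of "\<lambda>w. fst (\<psi> w)"])
    fix w assume "w \<in> fst G'"
    then show "fst (\<psi> w) \<in> S"
      unfolding V' using \<psi>f \<psi>i e VH by (auto simp: mem_Times_iff)
  next
    fix s assume s: "s \<in> S"
    let ?D = "insert s (pred_set S ltS s) \<times> (UNIV :: nat set)"
    \<comment> \<open>This set of edges may be larger than needed, but it is countable and contains
      every edge whose upper end lies over \<open>s\<close>.\<close>
    let ?L = "(\<lambda>(x, y). {x, y}) ` (?D \<times> ?D) \<inter> snd ?H"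
    have "{w \<in> fst G'. fst (\<psi> w) = s} \<subseteq> f ` ({s} \<times> UNIV) \<union> (\<Union>e\<in>?L. set (P e))"
    proof
      fix w assume w: "w \<in> {w \<in> fst G'. fst (\<psi> w) = s}"
      consider x where "x \<in> fst ?H" "w = f x" | e where "e \<in> snd ?H" "w \<in> ?inner P e"
        using w V' by blast
      then show "w \<in> f ` ({s} \<times> UNIV) \<union> (\<Union>e\<in>?L. set (P e))"
      proof cases
        case 1
        then have "x \<in> {s} \<times> UNIV" using w \<psi>f by (auto simp: mem_Times_iff)
        then show ?thesis using 1 by blast
      next
        case (2 d)
        then have hi: "fst (hi d) = s" using w \<psi>i by simp
        then have "(lo d, hi d) \<in> ?D \<times> ?D"
          using e[OF 2(1)] by (auto simp: pred_set_def mem_Times_iff)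
        moreover have "d = {lo d, hi d}" using e[OF 2(1)] by blast
        ultimately have "d \<in> ?L" using 2(1) by (auto intro!: image_eqI[of _ _ "(lo d, hi d)"])
        then show ?thesis using 2(2) inner_set by blast
      qed
    qed
    moreover have "countable (f ` ({s} \<times> UNIV) \<union> (\<Union>e\<in>?L. set (P e)))"
      using S(2)[OF s]
      by (intro countable_Un countable_image countable_UN countable_SIGMA countable_Int1)
        (auto intro: countable_finite)
    ultimately show "countable {w \<in> fst G'. fst (\<psi> w) = s}" by (rule countable_subset)
  next
    fix x y assume "{x, y} \<in> snd G'"
    then obtain d i where d: "d \<in> snd ?H" and i: "Suc i < length (P d)"
      and xy: "{x, y} = {P d ! i, P d ! Suc i}"
      unfolding E' path_edges_def by blast
    have "{x, y} \<subseteq> set (P d)" using i by (simp add: xy)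
    then have "\<psi> x \<in> d" "\<psi> y \<in> d" using \<psi>P[OF d] by auto
    then show "fst (\<psi> x) = fst (\<psi> y) \<or> ltS (fst (\<psi> x)) (fst (\<psi> y)) \<or> ltS (fst (\<psi> y)) (fst (\<psi> x))"
      using e[OF d] by auto
  qed
qed

theorem mainTheorem5:
  fixes T :: "'a set" and ltT :: "'a \<Rightarrow> 'a \<Rightarrow> bool" and A :: "nat \<Rightarrow> 'a set"
    and S :: "'b set" and ltS :: "'b \<Rightarrow> 'b \<Rightarrow> bool" and B :: "nat \<Rightarrow> 'b set"
  assumes "aronszajn_tree T ltT" and "semi_special T ltT" and "\<not> special T ltT"
    and "antichain_cover_succ T ltT A"
    and "aronszajn_tree S ltS" and "special S ltS"
    and "antichain_partition S ltS B"
  shows "\<forall>G' :: 'c graph. graph_iso (ray_inflation T ltT A) G' \<longrightarrow>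
           \<not> is_subdivision G' (ray_inflation S ltS B)"
proof (intro allI impI notI)
  fix G' :: "'c graph"
  assume iso: "graph_iso (ray_inflation T ltT A) G'"
    and sub: "is_subdivision G' (ray_inflation S ltS B)"
  have T: "is_tree T ltT" "\<And>v. v \<in> T \<Longrightarrow> countable (pred_set T ltT v)"
    and S: "is_tree S ltS" "\<And>v. v \<in> S \<Longrightarrow> countable (pred_set S ltS v)"
    using assms(1,5) by (auto simp: aronszajn_tree_def omega1_tree_def)
  have B: "antichain_cover_succ S ltS B"
    using assms(7) by (auto simp: antichain_partition_def antichain_cover_succ_def succ_node_def)
  obtain q :: "'c \<Rightarrow> 'b" where q: "\<And>w. w \<in> fst G' \<Longrightarrow> q w \<in> S"
    "\<And>s. s \<in> S \<Longrightarrow> countable {w \<in> fst G'. q w = s}"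
    "\<And>x y. {x, y} \<in> snd G' \<Longrightarrow> q x = q y \<or> ltS (q x) (q y) \<or> ltS (q y) (q x)"
    using subdivision_retraction[OF S B sub] by blast
  have VG: "fst (ray_inflation T ltT A) = T \<times> UNIV" by (simp add: ray_inflation_def)
  obtain g where g: "bij_betw g (T \<times> UNIV) (fst G')"
    and ge: "\<And>x y. \<lbrakk>x \<in> T \<times> UNIV; y \<in> T \<times> UNIV; {x, y} \<in> snd (ray_inflation T ltT A)\<rbrakk>
      \<Longrightarrow> {g x, g y} \<in> snd G'"
    using iso unfolding graph_iso_def VG by blast
  have gV: "g x \<in> fst G'" if "x \<in> T \<times> UNIV" for x using g that by (auto simp: bij_betw_def)
  have "special T ltT"
  \<comment> \<open>The map into \<open>S\<close> is the isomorphism followed by the retraction;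
    injectivity of \<open>g\<close> pulls countability of the fibres back to
    \<open>T \<times> UNIV\<close>.\<close>
  proof (rule special_transfer[OF T assms(4) S assms(6), where p = "\<lambda>x. q (g x)"])
    show "q (g x) \<in> S" if "x \<in> T \<times> UNIV" for x using q(1) gV that by blast
    show "countable {x \<in> T \<times> UNIV. q (g x) = s}" if "s \<in> S" for s
    proof (rule countable_image_inj_on)
      show "countable (g ` {x \<in> T \<times> UNIV. q (g x) = s})"
        by (rule countable_subset[OF _ q(2)[OF that]]) (use gV in blast)
      show "inj_on g {x \<in> T \<times> UNIV. q (g x) = s}"
        using g by (auto simp: bij_betw_def intro: inj_on_subset)
    qed
    show "q (g x) = q (g y) \<or> ltS (q (g x)) (q (g y)) \<or> ltS (q (g y)) (q (g x))"
      if "{x, y} \<in> snd (ray_inflation T ltT A)" "x \<in> T \<times> UNIV" "y \<in> T \<times> UNIV" for x y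
      using q(3) ge that by blast
  qed
  then show False using assms(3) by blast
qed

end
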